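(* Let $n\ge 2$ and $m\ge 0$ be integers, let $X$ be an algebraic system, and let $X_0,X_1,\dots,X_m$ be subsets of $X$ containing elements $x^i_1,\dots,x^i_n\in X_i$ ($i=0,1,\dots,m$) such that $\{x^i_1,\dots,x^i_n\}\cap\{x^k_1,\dots,x^k_n\}=\varnothing$ for $i\ne k$ and the set $\{x^i_j \mid 0\le i\le m,\ 1\le j\le n\}$ generates $X$. Let $S=(S_0,S_1,\dots,S_m)$ be an automorphic multi-switch (AMS) on $X$ with respect to the generating set $\{x^i_j \mid 0\le i\le m,\ 1\le j\le n\}$, with associated automorphisms $R_1,\dots,R_{n-1}$ of $X$. Then the map $\varphi_S:B_n\to \mathrm{Aut}(X)$ defined on the generators of the braid group $B_n$ by $$\varphi_S(\sigma_j)=R_j,\qquad j=1,2,\dots,n-1,$$ is a representation of $B_n$ (i.e. it extends to a group homomorphism $B_n\to \mathrm{Aut}(X)$).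
   Context: An algebraic system is a set with a family of algebraic operations (group, module, quandle, etc.). Composition: maps act on the right, $fg(x)=g(f(x))$; this is also the product in $\mathrm{Aut}(X)$. Braid group: $B_n$ has generators $\sigma_1,\dots,\sigma_{n-1}$ and relations $\sigma_i\sigma_{i+1}\sigma_i=\sigma_{i+1}\sigma_i\sigma_{i+1}$ ($1\le i\le n-2$) and $\sigma_i\sigma_j=\sigma_j\sigma_i$ ($|i-j|\ge 2$). Switch: a switch on a set $Y$ is a bijection $S:Y\times Y\to Y\times Y$ with $(S\times id)(id\times S)(S\times id)=(id\times S)(S\times id)(id\times S)$ on $Y^3$. Multi-switch: let $X_1,\dots,X_m$ be non-empty subsets of $X$. Identify $(X\times X_1\times\dots\times X_m)^2$ with $X^2\times X_1^2\times\dots\times X_m^2$. An $(m+1)$-switch (multi-switch) on $X$ is a map $S:X^2\times X_1^2\times\dots\times X_m^2\to X^2\times X_1^2\times\dots\times X_m^2$ that is a switch on $X\times X_1\times\dots\times X_m$ and has the form $S(c_0,c_1,\dots,c_m)=(S_0(c_0,c_1,\dots,c_m),S_1(c_1),\dots,S_m(c_m))$ for $c_0\in X^2$, $c_i\in X_i^2$, with maps $S_0:X^2\times X_1^2\times\dots\times X_m^2\to X^2$ and $S_i:X_i^2\to X_i^2$ ($i\ge1$). One writes $S=(S_0,\dots,S_m)$. The sets $X_i$ need not be subsystems. AMS: write $S_i=(S_i^l,S_i^r)$ for the two components of $S_i$, $i=0,\dots,m$. Assume each $S_i^l$, $S_i^r$ is given by a (fixed) word over its arguments in terms of the operations of $X$.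 For $j=1,\dots,n-1$ let $R_j:\{x^i_k\mid 0\le i\le m,\ 1\le k\le n\}\to X$ be given by $x^0_j\mapsto S_0^l(x^0_j,x^0_{j+1},x^1_j,x^1_{j+1},\dots,x^m_j,x^m_{j+1})$, $x^0_{j+1}\mapsto S_0^r(x^0_j,x^0_{j+1},x^1_j,x^1_{j+1},\dots,x^m_j,x^m_{j+1})$, $x^i_j\mapsto S_i^l(x^i_j,x^i_{j+1})$, $x^i_{j+1}\mapsto S_i^r(x^i_j,x^i_{j+1})$ for $i=1,\dots,m$, and $x^i_k\mapsto x^i_k$ for $k\notin\{j,j+1\}$, $0\le i\le m$. For a fixed $i$ the elements $x^i_1,\dots,x^i_n$ need not be distinct; it is assumed that each $R_j$ is well defined, i.e. equal elements have equal images. $S$ is called an automorphic multi-switch (AMS) on $X$ with respect to the generating set $\{x^i_j\}$ if all these assumptions hold and every $R_j$ ($1\le j\le n-1$) extends to an automorphism of $X$, again denoted $R_j$. *)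

theory Defs
  imports "HOL-Algebra.Bij"
begin

text \<open>
  The operations are indexed by the set \<open>opers\<close>, which may be empty. Only the values of
  \<open>operation M f\<close> on lists of length \<open>arity M f\<close> over the carrier are meaningful.
\<close>

record ('a, 'f) algsys = "'a partial_object" +
  opers :: "'f set"
  arity :: "'f \<Rightarrow> nat"
  operation :: "'f \<Rightarrow> 'a list \<Rightarrow> 'a"

definition algebraic_system :: "('a, 'f) algsys \<Rightarrow> bool" where
  "algebraic_system M \<longleftrightarrow>
     (\<forall>f\<in>opers M. \<forall>as\<in>lists (carrier M).
        length as = arity M f \<longrightarrow> operation M f as \<in> carrier M)"

inductive_set subsystem_generated :: "('a, 'f) algsys \<Rightarrow> 'a set \<Rightarrow> 'a set"
  for M :: "('a, 'f) algsys" and G :: "'a set" where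
  generator: "a \<in> G \<Longrightarrow> a \<in> subsystem_generated M G"
| operation: "\<lbrakk>f \<in> opers M; as \<in> lists (subsystem_generated M G); length as = arity M f\<rbrakk>
    \<Longrightarrow> operation M f as \<in> subsystem_generated M G"

text \<open>
  Maps act on the right, so the product \<open>f g\<close> of automorphisms is ``first \<open>f\<close>, then \<open>g\<close>'';
  this is opposite to \<^const>\<open>BijGroup\<close>. As there, the functions are extensional, so that
  an automorphism is determined by its values on the carrier.
\<close>

definition automorphisms :: "('a, 'f) algsys \<Rightarrow> ('a \<Rightarrow> 'a) set" where
  "automorphisms M = {h \<in> Bij (carrier M).
     \<forall>f\<in>opers M. \<forall>as\<in>lists (carrier M). length as = arity M f \<longrightarrow>
       h (operation M f as) = operation M f (map h as)}"

definition Aut :: "('a, 'f) algsys \<Rightarrow> ('a \<Rightarrow> 'a) monoid" where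
  "Aut M = \<lparr>carrier = automorphisms M,
            mult = (\<lambda>f g. compose (carrier M) g f),
            one = (\<lambda>x\<in>carrier M. x)\<rparr>"

datatype ('f, 'v) opword = Arg 'v | Op 'f "('f, 'v) opword list"

inductive_set opwords :: "('a, 'f) algsys \<Rightarrow> 'v set \<Rightarrow> ('f, 'v) opword set"
  for M :: "('a, 'f) algsys" and V :: "'v set" where
  Arg: "v \<in> V \<Longrightarrow> Arg v \<in> opwords M V"
| Op: "\<lbrakk>f \<in> opers M; ts \<in> lists (opwords M V); length ts = arity M f\<rbrakk>
    \<Longrightarrow> Op f ts \<in> opwords M V"

primrec eval_word :: "('a, 'f) algsys \<Rightarrow> ('v \<Rightarrow> 'a) \<Rightarrow> ('f, 'v) opword \<Rightarrow> 'a" where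
  "eval_word M \<rho> (Arg v) = \<rho> v"
| "eval_word M \<rho> (Op f ts) = operation M f (map (eval_word M \<rho>) ts)"

text \<open>
  \<open>F\<close> is given on \<open>D\<close> by one fixed word in the arguments \<open>V\<close>; \<open>arg c v\<close> is the value of the
  argument \<open>v\<close> at the point \<open>c\<close>.
\<close>

definition given_by_word ::
  "('a, 'f) algsys \<Rightarrow> 'v set \<Rightarrow> ('c \<Rightarrow> 'v \<Rightarrow> 'a) \<Rightarrow> 'c set \<Rightarrow> ('c \<Rightarrow> 'a) \<Rightarrow> bool" where
  "given_by_word M V arg D F \<longleftrightarrow>
     (\<exists>t\<in>opwords M V. \<forall>c\<in>D. F c = eval_word M (arg c) t)"

definition switch_on :: "'y set \<Rightarrow> ('y \<times> 'y \<Rightarrow> 'y \<times> 'y) \<Rightarrow> bool" where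
  "switch_on Y S \<longleftrightarrow> bij_betw S (Y \<times> Y) (Y \<times> Y) \<and>
     (let S12 = (\<lambda>(x, y, z). case S (x, y) of (x', y') \<Rightarrow> (x', y', z));
          S23 = (\<lambda>(x, y, z). (x, S (y, z)))
      in \<forall>t\<in>Y \<times> Y \<times> Y. S12 (S23 (S12 t)) = S23 (S12 (S23 t)))"

text \<open>
  The product \<open>X \<times> X\<^sub>1 \<times> \<dots> \<times> X\<^sub>m\<close> consists of the extensional functions on \<open>{..m}\<close> with these
  factors. The value of the family \<open>Xs\<close> at \<open>0\<close> does not enter: the factor at \<open>0\<close> is all of \<open>X\<close>.
\<close>

definition factor :: "('a, 'f) algsys \<Rightarrow> (nat \<Rightarrow> 'a set) \<Rightarrow> nat \<Rightarrow> 'a set" where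
  "factor M Xs i = (if i = 0 then carrier M else Xs i)"

definition prod_space :: "('a, 'f) algsys \<Rightarrow> nat \<Rightarrow> (nat \<Rightarrow> 'a set) \<Rightarrow> (nat \<Rightarrow> 'a) set" where
  "prod_space M m Xs = (\<Pi>\<^sub>E i\<in>{..m}. factor M Xs i)"

definition prod_squares ::
  "('a, 'f) algsys \<Rightarrow> nat \<Rightarrow> (nat \<Rightarrow> 'a set) \<Rightarrow> (nat \<Rightarrow> 'a \<times> 'a) set" where
  "prod_squares M m Xs = (\<Pi>\<^sub>E i\<in>{..m}. factor M Xs i \<times> factor M Xs i)"

text \<open>
  The identification of \<open>(X \<times> X\<^sub>1 \<times> \<dots> \<times> X\<^sub>m)\<^sup>2\<close> with \<open>X\<^sup>2 \<times> X\<^sub>1\<^sup>2 \<times> \<dots> \<times> X\<^sub>m\<^sup>2\<close>, and its inverse.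
\<close>

definition to_squares :: "nat \<Rightarrow> (nat \<Rightarrow> 'a) \<times> (nat \<Rightarrow> 'a) \<Rightarrow> nat \<Rightarrow> 'a \<times> 'a" where
  "to_squares m p = (\<lambda>i\<in>{..m}. (fst p i, snd p i))"

definition from_squares :: "nat \<Rightarrow> (nat \<Rightarrow> 'a \<times> 'a) \<Rightarrow> (nat \<Rightarrow> 'a) \<times> (nat \<Rightarrow> 'a)" where
  "from_squares m c = (\<lambda>i\<in>{..m}. fst (c i), \<lambda>i\<in>{..m}. snd (c i))"

text \<open>
  A multi-switch \<open>(S\<^sub>0, S\<^sub>1, \<dots>, S\<^sub>m)\<close> is represented by its components: \<open>S0\<close>, which depends on all
  pairs, and \<open>Ss i\<close> for \<open>1 \<le> i \<le> m\<close>; the value of \<open>Ss\<close> at \<open>0\<close> does not enter.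
\<close>

definition multi_map ::
  "nat \<Rightarrow> ((nat \<Rightarrow> 'a \<times> 'a) \<Rightarrow> 'a \<times> 'a) \<Rightarrow> (nat \<Rightarrow> 'a \<times> 'a \<Rightarrow> 'a \<times> 'a)
     \<Rightarrow> (nat \<Rightarrow> 'a \<times> 'a) \<Rightarrow> nat \<Rightarrow> 'a \<times> 'a" where
  "multi_map m S0 Ss c = (\<lambda>i\<in>{..m}. if i = 0 then S0 c else Ss i (c i))"

definition multi_switch ::
  "('a, 'f) algsys \<Rightarrow> nat \<Rightarrow> (nat \<Rightarrow> 'a set)
     \<Rightarrow> ((nat \<Rightarrow> 'a \<times> 'a) \<Rightarrow> 'a \<times> 'a) \<Rightarrow> (nat \<Rightarrow> 'a \<times> 'a \<Rightarrow> 'a \<times> 'a) \<Rightarrow> bool" where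
  "multi_switch M m Xs S0 Ss \<longleftrightarrow>
     (\<forall>i\<in>{1..m}. Xs i \<noteq> {} \<and> Xs i \<subseteq> carrier M) \<and>
     S0 \<in> prod_squares M m Xs \<rightarrow> carrier M \<times> carrier M \<and>
     (\<forall>i\<in>{1..m}. Ss i \<in> Xs i \<times> Xs i \<rightarrow> Xs i \<times> Xs i) \<and>
     switch_on (prod_space M m Xs) (from_squares m \<circ> multi_map m S0 Ss \<circ> to_squares m)"

definition pair_arg :: "'a \<times> 'a \<Rightarrow> bool \<Rightarrow> 'a" where
  "pair_arg p right = (if right then snd p else fst p)"

definition squares_arg :: "(nat \<Rightarrow> 'a \<times> 'a) \<Rightarrow> nat \<times> bool \<Rightarrow> 'a" where
  "squares_arg c v = pair_arg (c (fst v)) (snd v)"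

definition components_given_by_words ::
  "('a, 'f) algsys \<Rightarrow> nat \<Rightarrow> (nat \<Rightarrow> 'a set)
     \<Rightarrow> ((nat \<Rightarrow> 'a \<times> 'a) \<Rightarrow> 'a \<times> 'a) \<Rightarrow> (nat \<Rightarrow> 'a \<times> 'a \<Rightarrow> 'a \<times> 'a) \<Rightarrow> bool" where
  "components_given_by_words M m Xs S0 Ss \<longleftrightarrow>
     given_by_word M ({..m} \<times> UNIV) squares_arg (prod_squares M m Xs) (fst \<circ> S0) \<and>
     given_by_word M ({..m} \<times> UNIV) squares_arg (prod_squares M m Xs) (snd \<circ> S0) \<and>
     (\<forall>i\<in>{1..m}. given_by_word M UNIV pair_arg (Xs i \<times> Xs i) (fst \<circ> Ss i) \<and>
                 given_by_word M UNIV pair_arg (Xs i \<times> Xs i) (snd \<circ> Ss i))"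

text \<open>
  With \<open>x i k\<close> for \<open>x\<^sup>i\<^sub>k\<close>, this is the prescribed image of \<open>x\<^sup>i\<^sub>k\<close> under \<open>R\<^sub>j\<close>, as a function of the
  indices \<open>i\<close>, \<open>k\<close>. It may differ for index pairs naming the same element.
\<close>

definition R_image ::
  "nat \<Rightarrow> ((nat \<Rightarrow> 'a \<times> 'a) \<Rightarrow> 'a \<times> 'a) \<Rightarrow> (nat \<Rightarrow> 'a \<times> 'a \<Rightarrow> 'a \<times> 'a)
     \<Rightarrow> (nat \<Rightarrow> nat \<Rightarrow> 'a) \<Rightarrow> nat \<Rightarrow> nat \<Rightarrow> nat \<Rightarrow> 'a" where
  "R_image m S0 Ss x j i k =
     (let p = multi_map m S0 Ss (\<lambda>i\<in>{..m}. (x i j, x i (j + 1))) i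
      in if k = j then fst p else if k = j + 1 then snd p else x i k)"

definition extends_R ::
  "('a, 'f) algsys \<Rightarrow> nat \<Rightarrow> nat \<Rightarrow> ((nat \<Rightarrow> 'a \<times> 'a) \<Rightarrow> 'a \<times> 'a)
     \<Rightarrow> (nat \<Rightarrow> 'a \<times> 'a \<Rightarrow> 'a \<times> 'a) \<Rightarrow> (nat \<Rightarrow> nat \<Rightarrow> 'a) \<Rightarrow> nat \<Rightarrow> ('a \<Rightarrow> 'a) \<Rightarrow> bool" where
  "extends_R M m n S0 Ss x j h \<longleftrightarrow>
     h \<in> automorphisms M \<and> (\<forall>i\<in>{..m}. \<forall>k\<in>{1..n}. h (x i k) = R_image m S0 Ss x j i k)"

definition automorphic_multi_switch ::
  "('a, 'f) algsys \<Rightarrow> nat \<Rightarrow> nat \<Rightarrow> (nat \<Rightarrow> 'a set) \<Rightarrow> ((nat \<Rightarrow> 'a \<times> 'a) \<Rightarrow> 'a \<times> 'a)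
     \<Rightarrow> (nat \<Rightarrow> 'a \<times> 'a \<Rightarrow> 'a \<times> 'a) \<Rightarrow> (nat \<Rightarrow> nat \<Rightarrow> 'a) \<Rightarrow> bool" where
  "automorphic_multi_switch M m n Xs S0 Ss x \<longleftrightarrow>
     multi_switch M m Xs S0 Ss \<and>
     components_given_by_words M m Xs S0 Ss \<and>
     (\<forall>j\<in>{1..n - 1}.
        (\<forall>i\<in>{..m}. \<forall>k\<in>{1..n}. \<forall>i'\<in>{..m}. \<forall>k'\<in>{1..n}.
           x i k = x i' k' \<longrightarrow> R_image m S0 Ss x j i k = R_image m S0 Ss x j i' k') \<and>
        (\<exists>h. extends_R M m n S0 Ss x j h))"

text \<open>
  Words in the generators \<open>A\<close> are lists of letters \<open>(a, e)\<close>, where \<open>(a, True)\<close> stands for \<open>a\<close> and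
  \<open>(a, False)\<close> for its inverse. A defining relation \<open>r = s\<close> is a pair of words.
\<close>

type_synonym 'g gword = "('g \<times> bool) list"

definition gwords :: "'g set \<Rightarrow> 'g gword set" where
  "gwords A = lists (A \<times> UNIV)"

inductive word_equiv :: "'g set \<Rightarrow> ('g gword \<times> 'g gword) set \<Rightarrow> 'g gword \<Rightarrow> 'g gword \<Rightarrow> bool"
  for A :: "'g set" and Rel :: "('g gword \<times> 'g gword) set" where
  refl: "u \<in> gwords A \<Longrightarrow> word_equiv A Rel u u"
| sym: "word_equiv A Rel u v \<Longrightarrow> word_equiv A Rel v u"
| trans: "\<lbrakk>word_equiv A Rel u v; word_equiv A Rel v w\<rbrakk> \<Longrightarrow> word_equiv A Rel u w"
| cancel: "\<lbrakk>u \<in> gwords A; v \<in> gwords A; a \<in> A\<rbrakk>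
    \<Longrightarrow> word_equiv A Rel (u @ [(a, e), (a, \<not> e)] @ v) (u @ v)"
| relation: "\<lbrakk>u \<in> gwords A; v \<in> gwords A; (r, s) \<in> Rel; r \<in> gwords A; s \<in> gwords A\<rbrakk>
    \<Longrightarrow> word_equiv A Rel (u @ r @ v) (u @ s @ v)"

definition word_class ::
  "'g set \<Rightarrow> ('g gword \<times> 'g gword) set \<Rightarrow> 'g gword \<Rightarrow> 'g gword set" where
  "word_class A Rel u = {v. word_equiv A Rel u v}"

definition presented_group ::
  "'g set \<Rightarrow> ('g gword \<times> 'g gword) set \<Rightarrow> 'g gword set monoid" where
  "presented_group A Rel =
     \<lparr>carrier = word_class A Rel ` gwords A,
      mult = (\<lambda>P Q. \<Union>u\<in>P. \<Union>v\<in>Q. word_class A Rel (u @ v)),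
      one = word_class A Rel []\<rparr>"

definition braid_relations :: "nat \<Rightarrow> (nat gword \<times> nat gword) set" where
  "braid_relations n =
     {([(i, True), (i + 1, True), (i, True)], [(i + 1, True), (i, True), (i + 1, True)]) | i.
        1 \<le> i \<and> i + 2 \<le> n} \<union>
     {([(i, True), (j, True)], [(j, True), (i, True)]) | i j.
        i \<in> {1..n - 1} \<and> j \<in> {1..n - 1} \<and> (i + 2 \<le> j \<or> j + 2 \<le> i)}"

definition braid_group :: "nat \<Rightarrow> nat gword set monoid" where
  "braid_group n = presented_group {1..n - 1} (braid_relations n)"

definition braid_gen :: "nat \<Rightarrow> nat \<Rightarrow> nat gword set" where
  "braid_gen n j = word_class {1..n - 1} (braid_relations n) [(j, True)]"

end

theory Submission
  imports Defs
begin

text \<open>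
  The switch \<open>S\<close>, applied to the coordinates \<open>j\<close> and \<open>j + 1\<close>, gives maps \<open>T\<^sub>j\<close> on
  \<open>(X \<times> X\<^sub>1 \<times> \<dots> \<times> X\<^sub>m)\<^sup>n\<close>, which satisfy the braid relations. The generators form a point \<open>x\<close>
  of this space, and \<open>R\<^sub>j x = T\<^sub>j x\<close> with \<open>R\<^sub>j\<close> applied entrywise. Since \<open>S\<close> is given by words,
  automorphisms commute with the \<open>T\<^sub>j\<close> wherever both sides stay in the space. So applying first
  \<open>R\<^sub>a\<close>, then \<open>R\<^sub>b\<close>, then \<open>R\<^sub>c\<close> to \<open>x\<close> gives \<open>T\<^sub>a (T\<^sub>b (T\<^sub>c x))\<close>, and the relations between the
  \<open>T\<^sub>j\<close> become relations between the \<open>R\<^sub>j\<close> on a generating set.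
\<close>

section \<open>Groups given by a presentation\<close>

lemma gwords_append_iff [simp]: "u @ v \<in> gwords A \<longleftrightarrow> u \<in> gwords A \<and> v \<in> gwords A"
  by (auto simp: gwords_def)

lemma gwords_Nil [simp]: "[] \<in> gwords A"
  by (simp add: gwords_def)

lemma gwords_Cons [simp]: "p # w \<in> gwords A \<longleftrightarrow> fst p \<in> A \<and> w \<in> gwords A"
  by (cases p) (auto simp: gwords_def)

lemma word_equiv_gwords:
  assumes "word_equiv A Rel u v"
  shows "u \<in> gwords A" "v \<in> gwords A"
  using assms by (induction rule: word_equiv.induct) auto

text \<open>The rules \<open>cancel\<close> and \<open>relation\<close> already act inside a
  context, so the outer words \<open>p\<close> and \<open>q\<close> are absorbed into it.\<close>

lemma word_equiv_context:
  assumes "word_equiv A Rel u v" "p \<in> gwords A" "q \<in> gwords A"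
  shows "word_equiv A Rel (p @ u @ q) (p @ v @ q)"
  using assms
proof (induction rule: word_equiv.induct)
  case (refl u)
  then show ?case by (simp add: word_equiv.refl)
next
  case (sym u v)
  then show ?case by (blast intro: word_equiv.sym)
next
  case (trans u v w)
  then show ?case by (blast intro: word_equiv.trans)
next
  case (cancel u v a e)
  then show ?case
    using word_equiv.cancel[of "p @ u" A "v @ q" a Rel e] by simp
next
  case (relation u v r s)
  then show ?case
    using word_equiv.relation[of "p @ u" A "v @ q" r s Rel] by simp
qed

lemma word_equiv_append:
  assumes "word_equiv A Rel u u'" "word_equiv A Rel v v'"
  shows "word_equiv A Rel (u @ v) (u' @ v')"
proof (rule word_equiv.trans)
  show "word_equiv A Rel (u @ v) (u' @ v)"
    using word_equiv_context[OF assms(1), of "[]" v] word_equiv_gwords[OF assms(2)] by simp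
  show "word_equiv A Rel (u' @ v) (u' @ v')"
    using word_equiv_context[OF assms(2), of u' "[]"] word_equiv_gwords[OF assms(1)] by simp
qed

lemma word_class_eq_iff:
  assumes "u \<in> gwords A"
  shows "word_class A Rel u = word_class A Rel v \<longleftrightarrow> word_equiv A Rel u v"
proof
  assume "word_class A Rel u = word_class A Rel v"
  moreover have "u \<in> word_class A Rel u"
    using assms by (simp add: word_class_def word_equiv.refl)
  ultimately show "word_equiv A Rel u v"
    by (auto simp: word_class_def intro: word_equiv.sym)
qed (auto simp: word_class_def intro: word_equiv.sym word_equiv.trans)

text \<open>The product is a union over all representatives. By congruence all classes in it
  coincide, and since both index sets are non-empty the union is this one class.\<close>

lemma presented_group_mult:
  assumes "u \<in> gwords A" "v \<in> gwords A"
  shows "word_class A Rel u \<otimes>\<^bsub>presented_group A Rel\<^esub> word_class A Rel v = word_class A Rel (u @ v)"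
proof -
  have "word_class A Rel (u' @ v') = word_class A Rel (u @ v)"
    if "u' \<in> word_class A Rel u" "v' \<in> word_class A Rel v" for u' v'
    using that assms word_equiv_append[of A Rel u u' v v']
    by (simp add: word_class_def[of A Rel u] word_class_def[of A Rel v]
        word_class_eq_iff[of "u @ v", symmetric])
  moreover have "word_class A Rel u \<noteq> {}" "word_class A Rel v \<noteq> {}"
    using assms by (auto simp: word_class_def intro: word_equiv.refl)
  ultimately have "(\<Union>u'\<in>word_class A Rel u. \<Union>v'\<in>word_class A Rel v. word_class A Rel (u' @ v'))
      = word_class A Rel (u @ v)"
    by (intro SUP_eq_const) blast+
  then show ?thesis
    by (simp add: presented_group_def)
qed

lemma carrier_presented_group: "carrier (presented_group A Rel) = word_class A Rel ` gwords A"
  by (simp add: presented_group_def)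

lemma one_presented_group: "\<one>\<^bsub>presented_group A Rel\<^esub> = word_class A Rel []"
  by (simp add: presented_group_def)

section \<open>Inverse words and the group axioms\<close>

definition gword_inv :: "'g gword \<Rightarrow> 'g gword" where
  "gword_inv w = rev (map (\<lambda>(a, e). (a, \<not> e)) w)"

lemma gword_inv_in_gwords: "w \<in> gwords A \<Longrightarrow> gword_inv w \<in> gwords A"
  by (auto simp: gword_inv_def gwords_def in_lists_conv_set)

lemma word_equiv_inv_append:
  assumes "w \<in> gwords A"
  shows "word_equiv A Rel (gword_inv w @ w) []"
  using assms
proof (induction w)
  case Nil
  then show ?case by (simp add: gword_inv_def word_equiv.refl)
next
  case (Cons p w)
  obtain a e where p: "p = (a, e)" by fastforce
  \<comment> \<open>The inverse of \<open>p\<close> meets \<open>p\<close> in the middle of the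
    word. Writing the second exponent as \<open>\<not> \<not> e\<close> makes the pair an instance
    of \<open>cancel\<close>.\<close>
  with Cons.prems have "word_equiv A Rel (gword_inv w @ [(a, \<not> e), (a, \<not> \<not> e)] @ w) (gword_inv w @ w)"
    by (intro word_equiv.cancel) (auto simp: gword_inv_in_gwords)
  with Cons p show ?case
    by (auto simp: gword_inv_def intro: word_equiv.trans)
qed

lemma group_presented_group: "group (presented_group A Rel)"
proof (rule groupI)
  fix P assume "P \<in> carrier (presented_group A Rel)"
  then obtain w where w: "w \<in> gwords A" "P = word_class A Rel w"
    by (auto simp: carrier_presented_group)
  then have "word_class A Rel (gword_inv w) \<otimes>\<^bsub>presented_group A Rel\<^esub> P
      = \<one>\<^bsub>presented_group A Rel\<^esub>"
    by (simp add: presented_group_mult gword_inv_in_gwords one_presented_group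
        word_class_eq_iff word_equiv_inv_append)
  then show "\<exists>Q\<in>carrier (presented_group A Rel). Q \<otimes>\<^bsub>presented_group A Rel\<^esub> P
      = \<one>\<^bsub>presented_group A Rel\<^esub>"
    using w by (auto simp: carrier_presented_group gword_inv_in_gwords)
qed (auto simp: carrier_presented_group one_presented_group presented_group_mult)

section \<open>Values of words in a group and the universal property of a presentation\<close>

definition gword_value :: "('b, 'c) monoid_scheme \<Rightarrow> ('g \<Rightarrow> 'b) \<Rightarrow> 'g gword \<Rightarrow> 'b" where
  "gword_value G f w =
     foldr (\<lambda>(a, e) y. (if e then f a else inv\<^bsub>G\<^esub> f a) \<otimes>\<^bsub>G\<^esub> y) w \<one>\<^bsub>G\<^esub>"

lemma gword_value_Nil [simp]: "gword_value G f [] = \<one>\<^bsub>G\<^esub>"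
  by (simp add: gword_value_def)

lemma gword_value_Cons [simp]:
  "gword_value G f ((a, e) # w) = (if e then f a else inv\<^bsub>G\<^esub> f a) \<otimes>\<^bsub>G\<^esub> gword_value G f w"
  by (simp add: gword_value_def)

context group
begin

lemma gword_value_closed:
  assumes "f \<in> A \<rightarrow> carrier G" "w \<in> gwords A"
  shows "gword_value G f w \<in> carrier G"
  using assms(2)
proof (induction w)
  case (Cons p w)
  then show ?case using assms(1) by (cases p) (auto simp: Pi_iff)
qed simp

lemma gword_value_append:
  assumes "f \<in> A \<rightarrow> carrier G" "u \<in> gwords A" "v \<in> gwords A"
  shows "gword_value G f (u @ v) = gword_value G f u \<otimes> gword_value G f v"
  using assms(2)
proof (induction u)
  case Nil
  then show ?case using gword_value_closed[OF assms(1,3)] by simp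
next
  case (Cons p u)
  then show ?case
    using assms(1) gword_value_closed[OF assms(1,3)] gword_value_closed[OF assms(1), of u]
    by (cases p) (auto simp: m_assoc Pi_iff)
qed

text \<open>A cancelling pair contributes the factor \<open>\<one>\<close>, and a relation holds by
  \<open>rel\<close>. Both may be used inside a longer word because the value of a concatenation is
  the product of the values.\<close>

lemma gword_value_word_equiv:
  assumes f: "f \<in> A \<rightarrow> carrier G"
    and rel: "\<And>r s. (r, s) \<in> Rel \<Longrightarrow> gword_value G f r = gword_value G f s"
    and "word_equiv A Rel u v"
  shows "gword_value G f u = gword_value G f v"
  using assms(3)
proof (induction rule: word_equiv.induct)
  case (cancel u v a e)
  then have "f a \<in> carrier G" using f by auto
  then have "gword_value G f ([(a, e), (a, \<not> e)] @ v) = gword_value G f v"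
    using gword_value_closed[OF f \<open>v \<in> gwords A\<close>] by (simp add: m_assoc[symmetric])
  then show ?case
    using cancel by (simp add: gword_value_append[OF f] del: append.simps)
next
  case (relation u v r s)
  then show ?case by (simp add: gword_value_append[OF f] rel)
qed auto

text \<open>This is von Dyck's theorem: evaluation of words is constant on classes as soon as the
  defining relations hold in the target group.\<close>

theorem presented_group_hom_extension:
  assumes f: "f \<in> A \<rightarrow> carrier G"
    and rel: "\<And>r s. (r, s) \<in> Rel \<Longrightarrow> gword_value G f r = gword_value G f s"
  shows "\<exists>\<phi>. group_hom (presented_group A Rel) G \<phi> \<and>
             (\<forall>a\<in>A. \<phi> (word_class A Rel [(a, True)]) = f a)"
proof -
  \<comment> \<open>The choice of the representative is immaterial, since equivalent words have
    equal values.\<close>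
  define \<phi> where "\<phi> P = gword_value G f (SOME w. w \<in> P)" for P
  have \<phi>: "\<phi> (word_class A Rel u) = gword_value G f u" if "u \<in> gwords A" for u
  proof -
    have "u \<in> word_class A Rel u"
      using that by (simp add: word_class_def word_equiv.refl)
    then have "(SOME w. w \<in> word_class A Rel u) \<in> word_class A Rel u"
      by (rule someI)
    then have "word_equiv A Rel u (SOME w. w \<in> word_class A Rel u)"
      by (simp add: word_class_def)
    from gword_value_word_equiv[OF f rel this] show ?thesis by (simp add: \<phi>_def)
  qed
  have "\<phi> \<in> hom (presented_group A Rel) G"
    by (rule homI) (auto simp: carrier_presented_group presented_group_mult \<phi>
        gword_value_closed[OF f] gword_value_append[OF f])
  then have "group_hom (presented_group A Rel) G \<phi>"
    by (simp add: group_hom_def group_hom_axioms_def group_presented_group is_group)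
  moreover have "\<phi> (word_class A Rel [(a, True)]) = f a" if "a \<in> A" for a
    using that f by (auto simp: \<phi> Pi_iff)
  ultimately show ?thesis by blast
qed

end

section \<open>Automorphisms of algebraic systems\<close>

lemma automorphisms_closed: "h \<in> automorphisms M \<Longrightarrow> a \<in> carrier M \<Longrightarrow> h a \<in> carrier M"
  using Bij_imp_funcset by (fastforce simp: automorphisms_def)

lemma automorphisms_operation:
  assumes "h \<in> automorphisms M" "f \<in> opers M" "as \<in> lists (carrier M)" "length as = arity M f"
  shows "h (operation M f as) = operation M f (map h as)"
  using assms by (auto simp: automorphisms_def)

lemma compose_automorphisms:
  assumes M: "algebraic_system M" and g: "g \<in> automorphisms M" and h: "h \<in> automorphisms M"
  shows "compose (carrier M) g h \<in> automorphisms M"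
proof -
  have "compose (carrier M) g h (operation M f as) = operation M f (map (compose (carrier M) g h) as)"
    if f: "f \<in> opers M" and as: "as \<in> lists (carrier M)" "length as = arity M f" for f as
  proof -
    have "operation M f as \<in> carrier M"
      using M f as by (auto simp: algebraic_system_def)
    moreover have "map h as \<in> lists (carrier M)"
      using as automorphisms_closed[OF h] by (auto simp: in_lists_conv_set)
    moreover have "map (compose (carrier M) g h) as = map (g \<circ> h) as"
      using as by (auto simp: compose_def in_lists_conv_set)
    ultimately show ?thesis
      using as automorphisms_operation[OF g f, of "map h as"] automorphisms_operation[OF h f as]
      by (simp only: compose_def restrict_apply if_True length_map map_map)
  qed
  then show ?thesis
    using g h by (simp add: automorphisms_def compose_Bij)
qed

lemma id_automorphisms:
  assumes "algebraic_system M"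
  shows "(\<lambda>x\<in>carrier M. x) \<in> automorphisms M"
proof -
  have "map (\<lambda>x\<in>carrier M. x) as = as" if "as \<in> lists (carrier M)" for as
    using that by (induction as) auto
  then show ?thesis
    using assms by (auto simp: automorphisms_def id_Bij algebraic_system_def)
qed

lemma inv_automorphisms:
  assumes M: "algebraic_system M" and h: "h \<in> automorphisms M"
  shows "(\<lambda>x\<in>carrier M. inv_into (carrier M) h x) \<in> automorphisms M" (is "?g \<in> _")
proof -
  have bij: "bij_betw h (carrier M) (carrier M)" and hB: "h \<in> Bij (carrier M)"
    using h by (auto simp: automorphisms_def Bij_def)
  have gB: "?g \<in> Bij (carrier M)"
    by (rule restrict_inv_into_Bij[OF hB])
  have g_closed: "?g a \<in> carrier M" and hg: "h (?g a) = a" if "a \<in> carrier M" for a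
    using that bij by (auto simp: bij_betw_def f_inv_into_f inv_into_into)
  have gh: "?g (h a) = a" if "a \<in> carrier M" for a
    using that bij automorphisms_closed[OF h that] by (auto simp: bij_betw_def)
  have "?g (operation M f as) = operation M f (map ?g as)"
    if f: "f \<in> opers M" and as: "as \<in> lists (carrier M)" "length as = arity M f" for f as
  proof -
    have gas: "map ?g as \<in> lists (carrier M)"
      using as g_closed by (auto simp: in_lists_conv_set)
    \<comment> \<open>Applying \<open>h\<close> to the right-hand side of the claim restores the
      list \<open>as\<close>; afterwards \<open>h\<close> is cancelled by its left inverse
      \<open>?g\<close>.\<close>
    have "map h (map ?g as) = as"
      using as hg by (auto simp: in_lists_conv_set intro!: map_idI)
    then have "h (operation M f (map ?g as)) = operation M f as"
      using automorphisms_operation[OF h f gas] as by simp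
    moreover have "operation M f (map ?g as) \<in> carrier M"
      using M f gas as by (simp add: algebraic_system_def)
    ultimately show ?thesis
      using gh[of "operation M f (map ?g as)"] by simp
  qed
  with gB show ?thesis by (simp add: automorphisms_def)
qed

section \<open>The automorphism group\<close>

lemma Aut_simps [simp]:
  "carrier (Aut M) = automorphisms M"
  "f \<otimes>\<^bsub>Aut M\<^esub> g = compose (carrier M) g f"
  "\<one>\<^bsub>Aut M\<^esub> = (\<lambda>x\<in>carrier M. x)"
  by (simp_all add: Aut_def)

lemma group_Aut:
  assumes M: "algebraic_system M"
  shows "group (Aut M)"
proof (rule groupI)
  fix f g h
  assume f: "f \<in> carrier (Aut M)" and g: "g \<in> carrier (Aut M)" and h: "h \<in> carrier (Aut M)"
  show "f \<otimes>\<^bsub>Aut M\<^esub> g \<in> carrier (Aut M)"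
    using f g compose_automorphisms[OF M] by simp
  show "f \<otimes>\<^bsub>Aut M\<^esub> g \<otimes>\<^bsub>Aut M\<^esub> h = f \<otimes>\<^bsub>Aut M\<^esub> (g \<otimes>\<^bsub>Aut M\<^esub> h)"
    using f automorphisms_closed[of f M] by (auto simp: compose_def fun_eq_iff)
next
  show "\<one>\<^bsub>Aut M\<^esub> \<in> carrier (Aut M)"
    using id_automorphisms[OF M] by simp
next
  fix f assume f: "f \<in> carrier (Aut M)"
  then have ext: "f \<in> extensional (carrier M)" and bij: "bij_betw f (carrier M) (carrier M)"
    by (auto simp: automorphisms_def Bij_def)
  \<comment> \<open>The restricted identity is a unit only among extensional maps: off the carrier
    both sides are \<open>undefined\<close>.\<close>
  show "\<one>\<^bsub>Aut M\<^esub> \<otimes>\<^bsub>Aut M\<^esub> f = f"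
    using ext by (auto simp: compose_def fun_eq_iff extensional_def)
  define g where "g = (\<lambda>x\<in>carrier M. inv_into (carrier M) f x)"
  have "g \<in> automorphisms M"
    using inv_automorphisms[OF M] f by (simp add: g_def)
  moreover have "g \<otimes>\<^bsub>Aut M\<^esub> f = \<one>\<^bsub>Aut M\<^esub>"
    using bij by (auto simp: g_def compose_def fun_eq_iff bij_betw_def f_inv_into_f)
  ultimately show "\<exists>g\<in>carrier (Aut M). g \<otimes>\<^bsub>Aut M\<^esub> f = \<one>\<^bsub>Aut M\<^esub>"
    by auto
qed

text \<open>The elements of the carrier on which \<open>g\<close> and \<open>h\<close> agree form a
  subsystem containing \<open>G\<close>; off the carrier both maps agree by extensionality.\<close>

lemma automorphisms_eqI:
  assumes M: "algebraic_system M" and gen: "subsystem_generated M G = carrier M"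
    and g: "g \<in> automorphisms M" and h: "h \<in> automorphisms M"
    and eq: "\<And>a. a \<in> G \<Longrightarrow> g a = h a"
  shows "g = h"
proof (rule extensionalityI[of _ "carrier M"])
  show "g \<in> extensional (carrier M)" "h \<in> extensional (carrier M)"
    using g h by (auto simp: automorphisms_def Bij_def)
  fix a assume "a \<in> carrier M"
  then have "a \<in> subsystem_generated M G" by (simp add: gen)
  then show "g a = h a"
  proof (induction rule: subsystem_generated.induct)
    case (operation f as)
    then have "map g as = map h as" and "as \<in> lists (carrier M)"
      by (auto simp: gen[symmetric] in_lists_conv_set)
    with operation.hyps automorphisms_operation[OF g, of f as] automorphisms_operation[OF h, of f as]
    show ?case by metis
  qed (rule eq)
qed

text \<open>Homomorphisms commute with words. Membership in the carrier is carried through the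
  induction, since \<open>h\<close> is known to respect operations only on arguments from the
  carrier.\<close>

lemma automorphisms_eval_word:
  assumes M: "algebraic_system M" and h: "h \<in> automorphisms M"
    and \<rho>: "\<And>v. v \<in> V \<Longrightarrow> \<rho> v \<in> carrier M" "\<And>v. v \<in> V \<Longrightarrow> \<rho>' v = h (\<rho> v)"
    and t: "t \<in> opwords M V"
  shows "eval_word M \<rho> t \<in> carrier M \<and> h (eval_word M \<rho> t) = eval_word M \<rho>' t"
  using t
proof (induction rule: opwords.induct)
  case (Op f ts)
  let ?as = "map (eval_word M \<rho>) ts"
  have as: "?as \<in> lists (carrier M)" "length ?as = arity M f"
    using Op by (auto simp: in_lists_conv_set)
  moreover have "map h ?as = map (eval_word M \<rho>') ts"
    using Op.IH by (auto simp: in_lists_conv_set)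
  ultimately show ?case
    using M Op.hyps(1) automorphisms_operation[OF h Op.hyps(1) as]
    by (auto simp: algebraic_system_def simp del: map_map)
qed (use \<rho> in auto)

text \<open>The word describes \<open>F\<close> only on \<open>D\<close>, so the point
  \<open>c\<close> and its image \<open>c'\<close> must both lie in \<open>D\<close>.\<close>

lemma automorphisms_given_by_word:
  assumes "algebraic_system M" "h \<in> automorphisms M" "given_by_word M V arg D F"
    and "c \<in> D" "c' \<in> D"
    and "\<And>v. v \<in> V \<Longrightarrow> arg c v \<in> carrier M" "\<And>v. v \<in> V \<Longrightarrow> arg c' v = h (arg c v)"
  shows "h (F c) = F c'"
proof -
  from assms(3) obtain t where t: "t \<in> opwords M V" "\<forall>c\<in>D. F c = eval_word M (arg c) t"
    by (auto simp: given_by_word_def)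
  with automorphisms_eval_word[OF assms(1,2,6,7) t(1)] assms(4,5) show ?thesis
    by simp
qed

section \<open>The action of a multi-switch on arrays\<close>

text \<open>
  An array \<open>y\<close> stands for the \<open>n\<close>-tuple of its columns; \<^term>\<open>R_image m S0 Ss y j\<close> is the result of applying the switch to the
  columns \<open>j\<close> and \<open>j + 1\<close>.
\<close>

definition column :: "nat \<Rightarrow> (nat \<Rightarrow> nat \<Rightarrow> 'a) \<Rightarrow> nat \<Rightarrow> nat \<Rightarrow> 'a" where
  "column m y k = (\<lambda>i\<in>{..m}. y i k)"

definition switch_map ::
  "nat \<Rightarrow> ((nat \<Rightarrow> 'a \<times> 'a) \<Rightarrow> 'a \<times> 'a) \<Rightarrow> (nat \<Rightarrow> 'a \<times> 'a \<Rightarrow> 'a \<times> 'a)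
     \<Rightarrow> (nat \<Rightarrow> 'a) \<times> (nat \<Rightarrow> 'a) \<Rightarrow> (nat \<Rightarrow> 'a) \<times> (nat \<Rightarrow> 'a)" where
  "switch_map m S0 Ss = from_squares m \<circ> multi_map m S0 Ss \<circ> to_squares m"

text \<open>Passes from the entrywise prescription to whole columns, the form in which the switch
  equation applies.\<close>

lemma column_R_image:
  "column m (R_image m S0 Ss y j) k =
     (if k = j then fst (switch_map m S0 Ss (column m y j, column m y (j + 1)))
      else if k = j + 1 then snd (switch_map m S0 Ss (column m y j, column m y (j + 1)))
      else column m y k)"
proof -
  have "to_squares m (column m y j, column m y (j + 1)) = (\<lambda>i\<in>{..m}. (y i j, y i (j + 1)))"
    by (auto simp: to_squares_def column_def)
  then have "switch_map m S0 Ss (column m y j, column m y (j + 1))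
      = from_squares m (multi_map m S0 Ss (\<lambda>i\<in>{..m}. (y i j, y i (j + 1))))"
    by (simp add: switch_map_def)
  then show ?thesis
    by (auto simp: column_def[of m _ k] R_image_def from_squares_def)
qed

lemma column_eq_iff: "column m y k = column m z k \<longleftrightarrow> (\<forall>i\<le>m. y i k = z i k)"
  by (auto simp: column_def fun_eq_iff)

text \<open>The bound \<open>j \<le> n - 1\<close> keeps both columns that enter the switch among
  the \<open>n\<close> columns where \<open>y\<close> and \<open>z\<close> are known to
  agree.\<close>

lemma R_image_cong:
  assumes "\<And>k. k \<in> {1..n} \<Longrightarrow> column m y k = column m z k"
    and "j \<in> {1..n - 1}" "k \<in> {1..n}"
  shows "column m (R_image m S0 Ss y j) k = column m (R_image m S0 Ss z j) k"
proof -
  have "j \<in> {1..n}" "j + 1 \<in> {1..n}" using assms(2) by auto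
  with assms show ?thesis by (simp add: column_R_image)
qed

text \<open>Plays the role of the \<open>n\<close>-th power of the product space. Entries with
  indices out of range are unconstrained, so arrays are compared column by column and not as
  functions.\<close>

definition arrays :: "('a, 'f) algsys \<Rightarrow> nat \<Rightarrow> nat \<Rightarrow> (nat \<Rightarrow> 'a set) \<Rightarrow> (nat \<Rightarrow> nat \<Rightarrow> 'a) set" where
  "arrays M m n Xs = {y. \<forall>k\<in>{1..n}. column m y k \<in> prod_space M m Xs}"

lemma arrays_iff: "y \<in> arrays M m n Xs \<longleftrightarrow> (\<forall>i\<le>m. \<forall>k\<in>{1..n}. y i k \<in> factor M Xs i)"
  by (auto simp: arrays_def column_def prod_space_def PiE_iff)

lemma arrays_cong:
  assumes "\<And>k. k \<in> {1..n} \<Longrightarrow> column m y k = column m z k"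
  shows "y \<in> arrays M m n Xs \<longleftrightarrow> z \<in> arrays M m n Xs"
  using assms by (auto simp: arrays_def)

text \<open>The two pairs of columns are disjoint, so neither switch changes the input of the
  other.\<close>

lemma R_image_far_commute:
  assumes "i + 2 \<le> j \<or> j + 2 \<le> i"
  shows "column m (R_image m S0 Ss (R_image m S0 Ss y i) j) k
       = column m (R_image m S0 Ss (R_image m S0 Ss y j) i) k"
  using assms by (auto simp: column_R_image)

section \<open>The maps on arrays induced by an automorphic multi-switch\<close>

locale ams =
  fixes M :: "('a, 'f) algsys" and m n :: nat and Xs :: "nat \<Rightarrow> 'a set"
    and S0 :: "(nat \<Rightarrow> 'a \<times> 'a) \<Rightarrow> 'a \<times> 'a" and Ss :: "nat \<Rightarrow> 'a \<times> 'a \<Rightarrow> 'a \<times> 'a"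
    and x :: "nat \<Rightarrow> nat \<Rightarrow> 'a" and R :: "nat \<Rightarrow> 'a \<Rightarrow> 'a"
  assumes algebraic: "algebraic_system M"
    and switch: "multi_switch M m Xs S0 Ss"
    and words: "components_given_by_words M m Xs S0 Ss"
    and x_arrays: "x \<in> arrays M m n Xs"
    and x_generates: "subsystem_generated M {x i k | i k. i \<le> m \<and> k \<in> {1..n}} = carrier M"
    and R_extends: "\<And>j. j \<in> {1..n - 1} \<Longrightarrow> extends_R M m n S0 Ss x j (R j)"
begin

abbreviation act :: "nat \<Rightarrow> (nat \<Rightarrow> nat \<Rightarrow> 'a) \<Rightarrow> nat \<Rightarrow> nat \<Rightarrow> 'a" where
  "act j y \<equiv> R_image m S0 Ss y j"

abbreviation Ys :: "(nat \<Rightarrow> nat \<Rightarrow> 'a) set" where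
  "Ys \<equiv> arrays M m n Xs"

lemma factor_subset: "i \<le> m \<Longrightarrow> factor M Xs i \<subseteq> carrier M"
  using switch by (auto simp: factor_def multi_switch_def)

lemma arrays_carrier: "y \<in> Ys \<Longrightarrow> i \<le> m \<Longrightarrow> k \<in> {1..n} \<Longrightarrow> y i k \<in> carrier M"
  using factor_subset[of i] unfolding arrays_iff by blast

lemma switch_map_switch: "switch_on (prod_space M m Xs) (switch_map m S0 Ss)"
  using switch by (simp add: multi_switch_def switch_map_def)

lemma switch_map_closed:
  assumes "p \<in> prod_space M m Xs" "q \<in> prod_space M m Xs"
  shows "fst (switch_map m S0 Ss (p, q)) \<in> prod_space M m Xs"
    "snd (switch_map m S0 Ss (p, q)) \<in> prod_space M m Xs"
proof -
  have "switch_map m S0 Ss (p, q) \<in> prod_space M m Xs \<times> prod_space M m Xs"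
    using switch_map_switch assms by (auto simp: switch_on_def dest!: bij_betwE)
  then show "fst (switch_map m S0 Ss (p, q)) \<in> prod_space M m Xs"
    "snd (switch_map m S0 Ss (p, q)) \<in> prod_space M m Xs" by auto
qed

lemma act_arrays:
  assumes "y \<in> Ys" "j \<in> {1..n - 1}"
  shows "act j y \<in> Ys"
proof -
  have "j \<in> {1..n}" "j + 1 \<in> {1..n}" using assms(2) by auto
  with assms(1) show ?thesis
    by (auto simp: arrays_def column_R_image intro!: switch_map_closed)
qed

text \<open>On the columns \<open>j\<close>, \<open>j + 1\<close>, \<open>j + 2\<close> this is the
  switch equation, read componentwise; every other column is fixed by both sides.\<close>

lemma act_braid:
  assumes y: "y \<in> Ys" and j: "1 \<le> j" "j + 2 \<le> n"
  shows "column m (act j (act (j + 1) (act j y))) k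
       = column m (act (j + 1) (act j (act (j + 1) y))) k"
proof -
  let ?S = "switch_map m S0 Ss"
  let ?p = "column m y j" and ?q = "column m y (j + 1)" and ?r = "column m y (j + 2)"
  have "?p \<in> prod_space M m Xs" "?q \<in> prod_space M m Xs" "?r \<in> prod_space M m Xs"
    using y j by (auto simp: arrays_def)
  then have "(?p, ?q, ?r) \<in> prod_space M m Xs \<times> prod_space M m Xs \<times> prod_space M m Xs"
    by simp
  from bspec[OF switch_map_switch[unfolded switch_on_def Let_def, THEN conjunct2] this]
  show ?thesis
    by (simp add: column_R_image split_beta prod_eq_iff)
qed

text \<open>Automorphisms commute with the fixed words that give the switch. The assumption
  \<open>hy\<close> is essential to the argument: \<open>h\<close> may move elements out of the sets
  \<open>Xs i\<close>, and the words describe the switch only on these sets.\<close>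

lemma automorphisms_act:
  assumes h: "h \<in> automorphisms M" and y: "y \<in> Ys" and hy: "(\<lambda>i k. h (y i k)) \<in> Ys"
    and j: "j \<in> {1..n - 1}" and i: "i \<le> m" and k: "k \<in> {1..n}"
  shows "h (act j y i k) = act j (\<lambda>i k. h (y i k)) i k"
proof -
  have jn: "j \<in> {1..n}" "j + 1 \<in> {1..n}" using j by auto
  let ?c = "\<lambda>i\<in>{..m}. (y i j, y i (j + 1))"
  let ?c' = "\<lambda>i\<in>{..m}. (h (y i j), h (y i (j + 1)))"
  have c: "?c \<in> prod_squares M m Xs" "?c' \<in> prod_squares M m Xs"
    using y hy jn by (auto simp: prod_squares_def arrays_iff)
  have yc: "y i k \<in> carrier M" if "i \<le> m" "k \<in> {1..n}" for i k
    using that y by (rule arrays_carrier[rotated])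
  have "h (fst (multi_map m S0 Ss ?c i)) = fst (multi_map m S0 Ss ?c' i) \<and>
        h (snd (multi_map m S0 Ss ?c i)) = snd (multi_map m S0 Ss ?c' i)"
  \<comment> \<open>The components of \<open>S0\<close> are words in the entries of all pairs, those
    of \<open>Ss i\<close> in the entries of the pair with index \<open>i\<close> alone.\<close>
  proof (cases "i = 0")
    case True
    have arg: "squares_arg ?c v \<in> carrier M" "squares_arg ?c' v = h (squares_arg ?c v)"
      if "v \<in> {..m} \<times> UNIV" for v
      using that yc jn by (auto simp: squares_arg_def pair_arg_def)
    have words0: "given_by_word M ({..m} \<times> UNIV) squares_arg (prod_squares M m Xs) (fst \<circ> S0)"
      "given_by_word M ({..m} \<times> UNIV) squares_arg (prod_squares M m Xs) (snd \<circ> S0)"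
      using words by (auto simp: components_given_by_words_def)
    have "h ((fst \<circ> S0) ?c) = (fst \<circ> S0) ?c'" "h ((snd \<circ> S0) ?c) = (snd \<circ> S0) ?c'"
      by (rule automorphisms_given_by_word[OF algebraic h words0(1) c]
          automorphisms_given_by_word[OF algebraic h words0(2) c]; erule arg)+
    with True show ?thesis
      by (simp add: multi_map_def)
  next
    case False
    with i have i': "i \<in> {1..m}" by auto
    let ?p = "(y i j, y i (j + 1))" and ?p' = "(h (y i j), h (y i (j + 1)))"
    have p: "?p \<in> Xs i \<times> Xs i" "?p' \<in> Xs i \<times> Xs i"
      using y hy jn i False by (auto simp: arrays_iff factor_def)
    have arg: "pair_arg ?p v \<in> carrier M" "pair_arg ?p' v = h (pair_arg ?p v)"
      if "v \<in> UNIV" for v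
      using yc jn i by (auto simp: pair_arg_def)
    have words_i: "given_by_word M UNIV pair_arg (Xs i \<times> Xs i) (fst \<circ> Ss i)"
      "given_by_word M UNIV pair_arg (Xs i \<times> Xs i) (snd \<circ> Ss i)"
      using words i' by (auto simp: components_given_by_words_def)
    have "h ((fst \<circ> Ss i) ?p) = (fst \<circ> Ss i) ?p'" "h ((snd \<circ> Ss i) ?p) = (snd \<circ> Ss i) ?p'"
      by (rule automorphisms_given_by_word[OF algebraic h words_i(1) p]
          automorphisms_given_by_word[OF algebraic h words_i(2) p]; erule arg)+
    with i False show ?thesis
      by (simp add: multi_map_def)
  qed
  then show ?thesis by (auto simp: R_image_def Let_def)
qed

section \<open>Products of the automorphisms on the generators\<close>

lemma R_automorphism: "j \<in> {1..n - 1} \<Longrightarrow> R j \<in> automorphisms M"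
  using R_extends by (simp add: extends_R_def)

lemma R_x: "j \<in> {1..n - 1} \<Longrightarrow> i \<le> m \<Longrightarrow> k \<in> {1..n} \<Longrightarrow> R j (x i k) = act j x i k"
  using R_extends by (simp add: extends_R_def)

abbreviation acts :: "nat list \<Rightarrow> (nat \<Rightarrow> nat \<Rightarrow> 'a) \<Rightarrow> nat \<Rightarrow> nat \<Rightarrow> 'a" where
  "acts js y \<equiv> foldr act js y"

lemma acts_arrays: "y \<in> Ys \<Longrightarrow> set js \<subseteq> {1..n - 1} \<Longrightarrow> acts js y \<in> Ys"
  by (induction js) (auto intro: act_arrays)

text \<open>In \<open>acts\<close> the last index of the list acts first. The automorphism
  \<open>R j\<close> is moved inward past all of \<open>js\<close> until it meets \<open>x\<close>,
  where it agrees with \<open>act j\<close>; hence \<open>j\<close> appears at the end.\<close>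

lemma R_acts:
  assumes "j \<in> {1..n - 1}" "set js \<subseteq> {1..n - 1}" "i \<le> m" "k \<in> {1..n}"
  shows "R j (acts js x i k) = acts (js @ [j]) x i k"
  using assms(2-)
proof (induction js arbitrary: i k)
  case Nil
  then show ?case using R_x[OF assms(1)] by simp
next
  case (Cons l js)
  let ?y = "acts js x" and ?z = "acts (js @ [j]) x"
  have yz: "column m (\<lambda>i k. R j (?y i k)) k = column m ?z k" if "k \<in> {1..n}" for k
    using that Cons by (auto simp: column_eq_iff)
  have "?y \<in> Ys" "?z \<in> Ys"
    using Cons.prems assms(1) by (auto intro!: acts_arrays act_arrays x_arrays)
  \<comment> \<open>The induction hypothesis also supplies the missing membership: the entrywise
    image of \<open>?y\<close> under \<open>R j\<close> has the same columns as \<open>?z\<close>,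
    which is obtained from \<open>x\<close> by switches and so stays in the space.\<close>
  moreover from this have "(\<lambda>i k. R j (?y i k)) \<in> Ys"
    using arrays_cong[OF yz] by blast
  ultimately have "R j (act l ?y i k) = act l (\<lambda>i k. R j (?y i k)) i k"
    using Cons.prems by (intro automorphisms_act R_automorphism assms(1)) auto
  also have "\<dots> = act l ?z i k"
    using R_image_cong[OF yz, where j = l and k = k] Cons.prems by (auto simp: column_eq_iff)
  finally show ?case by simp
qed

text \<open>Reduces an equation between products in \<open>Aut M\<close> to one between iterated
  switches at the single array \<open>x\<close>, because the entries of \<open>x\<close> generate
  the system.\<close>

lemma R_product_eqI:
  assumes "\<And>k. column m (acts js x) k = column m (acts ls x) k"
    and "set js \<subseteq> {1..n - 1}" "set ls \<subseteq> {1..n - 1}"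
  shows "gword_value (Aut M) R (map (\<lambda>j. (j, True)) js)
       = gword_value (Aut M) R (map (\<lambda>j. (j, True)) ls)"
proof -
  interpret Aut: group "Aut M" by (rule group_Aut[OF algebraic])
  have R: "R \<in> {1..n - 1} \<rightarrow> carrier (Aut M)"
    using R_automorphism by auto
  have closed: "gword_value (Aut M) R (map (\<lambda>j. (j, True)) js) \<in> automorphisms M"
    if "set js \<subseteq> {1..n - 1}" for js
  proof -
    have "map (\<lambda>j. (j, True)) js \<in> gwords {1..n - 1}"
      using that by (auto simp: gwords_def in_lists_conv_set)
    from Aut.gword_value_closed[OF R this] show ?thesis by simp
  qed
  \<comment> \<open>The list \<open>ls\<close> records the automorphisms already applied. As maps
    act on the right, the first letter of \<open>js\<close> is applied next and moves to the end of
    \<open>ls\<close>; the case of empty \<open>ls\<close> is the one needed.\<close>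
  have value_acts: "gword_value (Aut M) R (map (\<lambda>j. (j, True)) js) (acts ls x i k) = acts (ls @ js) x i k"
    if "set js \<subseteq> {1..n - 1}" "set ls \<subseteq> {1..n - 1}" "i \<le> m" "k \<in> {1..n}" for js ls i k
    using that
  proof (induction js arbitrary: ls)
    case Nil
    \<comment> \<open>The unit of \<open>Aut M\<close> is the identity on the carrier only, so
      membership has to be known.\<close>
    have "acts ls x i k \<in> carrier M"
      using acts_arrays[OF x_arrays] Nil by (intro arrays_carrier)
    then show ?case by simp
  next
    case (Cons j js)
    have "acts ls x i k \<in> carrier M"
      using acts_arrays[OF x_arrays] Cons.prems by (intro arrays_carrier)
    then show ?case
      using Cons.prems R_acts[of j ls i k] Cons.IH[of "ls @ [j]"] by (simp add: compose_def)
  qed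
  show ?thesis
  proof (rule automorphisms_eqI[OF algebraic x_generates closed[OF assms(2)] closed[OF assms(3)]])
    fix a assume "a \<in> {x i k | i k. i \<le> m \<and> k \<in> {1..n}}"
    then obtain i k where "a = x i k" "i \<le> m" "k \<in> {1..n}" by auto
    then show "gword_value (Aut M) R (map (\<lambda>j. (j, True)) js) a
        = gword_value (Aut M) R (map (\<lambda>j. (j, True)) ls) a"
      using value_acts[of js "[]" i k] value_acts[of ls "[]" i k] assms by (simp add: column_eq_iff)
  qed
qed

lemma R_braid_relations:
  assumes "(r, s) \<in> braid_relations n"
  shows "gword_value (Aut M) R r = gword_value (Aut M) R s"
  using assms unfolding braid_relations_def
proof (elim UnE CollectE exE conjE Pair_inject)
  fix i assume rs: "r = [(i, True), (i + 1, True), (i, True)]"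
      "s = [(i + 1, True), (i, True), (i + 1, True)]" and i: "1 \<le> i" "i + 2 \<le> n"
  have "gword_value (Aut M) R (map (\<lambda>j. (j, True)) [i, i + 1, i])
      = gword_value (Aut M) R (map (\<lambda>j. (j, True)) [i + 1, i, i + 1])"
  proof (rule R_product_eqI)
    show "column m (acts [i, i + 1, i] x) k = column m (acts [i + 1, i, i + 1] x) k" for k
      using act_braid[OF x_arrays i] by simp
  qed (use i in auto)
  with rs show ?thesis by (simp only: list.map)
next
  fix i j assume rs: "r = [(i, True), (j, True)]" "s = [(j, True), (i, True)]"
    and ij: "i \<in> {1..n - 1}" "j \<in> {1..n - 1}" "i + 2 \<le> j \<or> j + 2 \<le> i"
  have "gword_value (Aut M) R (map (\<lambda>j. (j, True)) [i, j])
      = gword_value (Aut M) R (map (\<lambda>j. (j, True)) [j, i])"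
  proof (rule R_product_eqI)
    show "column m (acts [i, j] x) k = column m (acts [j, i] x) k" for k
      \<comment> \<open>The indices are exchanged in this instance because
        \<open>acts [i, j] x\<close> applies the switch at \<open>j\<close> before the one at
        \<open>i\<close>.\<close>
      using R_image_far_commute[of j i m S0 Ss x] ij(3) by auto
  qed (use ij in auto)
  with rs show ?thesis by (simp only: list.map)
qed

end

theorem theorem1:
  fixes M :: "('a, 'f) algsys" and n m :: nat
    and Xs :: "nat \<Rightarrow> 'a set" and x :: "nat \<Rightarrow> nat \<Rightarrow> 'a"
    and S0 :: "(nat \<Rightarrow> 'a \<times> 'a) \<Rightarrow> 'a \<times> 'a"
    and Ss :: "nat \<Rightarrow> 'a \<times> 'a \<Rightarrow> 'a \<times> 'a"
    and R :: "nat \<Rightarrow> 'a \<Rightarrow> 'a"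
  assumes "n \<ge> 2"
    and "algebraic_system M"
    and "\<And>i. i \<le> m \<Longrightarrow> Xs i \<subseteq> carrier M"
    and "\<And>i k. i \<le> m \<Longrightarrow> k \<in> {1..n} \<Longrightarrow> x i k \<in> Xs i"
    and "\<And>i k. i \<le> m \<Longrightarrow> k \<le> m \<Longrightarrow> i \<noteq> k \<Longrightarrow> x i ` {1..n} \<inter> x k ` {1..n} = {}"
    and "subsystem_generated M {x i k | i k. i \<le> m \<and> k \<in> {1..n}} = carrier M"
    and "automorphic_multi_switch M m n Xs S0 Ss x"
    and "\<And>j. j \<in> {1..n - 1} \<Longrightarrow> extends_R M m n S0 Ss x j (R j)"
  shows "\<exists>\<phi>. group_hom (braid_group n) (Aut M) \<phi> \<and>
             (\<forall>j\<in>{1..n - 1}. \<phi> (braid_gen n j) = R j)"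
proof -
  interpret ams M m n Xs S0 Ss x R
  proof
    show "multi_switch M m Xs S0 Ss" "components_given_by_words M m Xs S0 Ss"
      using assms(7) by (auto simp: automorphic_multi_switch_def)
    \<comment> \<open>At index \<open>0\<close> the factor is the whole carrier, which contains
      \<open>Xs 0\<close>; at the other indices it is \<open>Xs i\<close> itself.\<close>
    show "x \<in> arrays M m n Xs"
      using assms(3,4) by (fastforce simp: arrays_iff factor_def)
  qed (use assms in auto)
  have "R \<in> {1..n - 1} \<rightarrow> carrier (Aut M)"
    using R_automorphism by auto
  \<comment> \<open>The universal property is applied to the presentation of the braid group, whose
    relations have been verified for the \<open>R j\<close>.\<close>
  from group.presented_group_hom_extension[OF group_Aut[OF algebraic] this R_braid_relations]
  show ?thesis
    by (auto simp: braid_group_def braid_gen_def)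
qed

end
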